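(* Let $\{(\bm{A}_i,B_i)\}_{i=1}^n$ be a binary sample with $\bm{A}_i\in\{-1,1\}^p$ and $B_i\in\{-1,1\}$, such that $\mathcal{A}^\top\mathcal{A}$ is positive definite, and let $\hat{\bm{\beta}}=(\mathcal{A}^\top\mathcal{A})^{-1}\mathcal{A}^\top\mathcal{B}$. Then the following are equivalent: 1. $\|\hat{\bm{\beta}}\|_2=1$. 2. $\hat{\bm{\beta}}$ is a vertex of the hypercube $\{\bm{x}\in\mathbb{R}^{2^p}:\|\mathbf{H}_{2^p}\bm{x}\|_\infty\le 1\}$. 3. $B_i=\hat{\bm{\beta}}^\top\bm{A}_i^{\otimes}$ for all $1\le i\le n$.
   Context: For $\bm{A}\in\{-1,1\}^p$, $\bm{A}^{\otimes}=\begin{pmatrix}1\\ A_1\end{pmatrix}\otimes\cdots\otimes\begin{pmatrix}1\\ A_p\end{pmatrix}\in\{-1,1\}^{2^p}$. $\mathcal{B}=(B_1,\dots,B_n)^\top$, and $\mathcal{A}$ is the $n\times 2^p$ matrix with rows $\bm{A}_1^{\otimes\top},\dots,\bm{A}_n^{\otimes\top}$. $\mathbf{H}_{2^p}$ is the Sylvester Hadamard matrix ($\mathbf{H}_1=(1)$, $\mathbf{H}_{2m}=\begin{pmatrix}\mathbf{H}_m&\mathbf{H}_m\\ \mathbf{H}_m&-\mathbf{H}_m\end{pmatrix}$), whose rows are the $2^p$ possible values of $\bm{A}^{\otimes}$. *)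

theory Defs
  imports Complex_Main
    "Jordan_Normal_Form.Matrix"
    "Jordan_Normal_Form.Gauss_Jordan_Elimination"
begin

text \<open>
  The dimension \<open>2 ^ p\<close> of the ambient space varies with \<open>p\<close>, so vectors and matrices are those
  of Jordan-Normal-Form, with explicit dimensions; all indices start from 0.
\<close>

definition kron_vec :: "real vec \<Rightarrow> real vec \<Rightarrow> real vec" where
  "kron_vec u v = vec (dim_vec u * dim_vec v)
     (\<lambda>i. u $ (i div dim_vec v) * v $ (i mod dim_vec v))"

text \<open>The product is associated to the right, ending in the empty Kronecker product \<open>(1)\<close>.\<close>

definition kron_lift :: "real vec \<Rightarrow> real vec" where
  "kron_lift a = foldr (\<lambda>x. kron_vec (vec_of_list [1, x])) (list_of_vec a) (vec_of_list [1])"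

definition design_mat :: "nat \<Rightarrow> nat \<Rightarrow> (nat \<Rightarrow> real vec) \<Rightarrow> real mat" where
  "design_mat p n A = mat n (2 ^ p) (\<lambda>(i, j). kron_lift (A i) $ j)"

text \<open>\<open>sylvester_hadamard k\<close> is the Sylvester matrix of order \<open>2 ^ k\<close>.\<close>

fun sylvester_hadamard :: "nat \<Rightarrow> real mat" where
  "sylvester_hadamard 0 = 1\<^sub>m 1"
| "sylvester_hadamard (Suc k) =
     (let H = sylvester_hadamard k in four_block_mat H H H (- H))"

definition pos_def_mat :: "real mat \<Rightarrow> bool" where
  "pos_def_mat M \<longleftrightarrow> square_mat M \<and> transpose_mat M = M \<and>
     (\<forall>v \<in> carrier_vec (dim_row M). v \<noteq> 0\<^sub>v (dim_row M) \<longrightarrow> v \<bullet> (M *\<^sub>v v) > 0)"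

text \<open>
  \<open>mat_inverse\<close> returns \<open>None\<close> on singular matrices, so the estimator is only meaningful when the
  Gram matrix is invertible, e.g. positive definite.
\<close>

definition beta_hat :: "nat \<Rightarrow> nat \<Rightarrow> (nat \<Rightarrow> real vec) \<Rightarrow> (nat \<Rightarrow> real) \<Rightarrow> real vec" where
  "beta_hat p n A B =
     (let X = design_mat p n A
      in the (mat_inverse (transpose_mat X * X)) *\<^sub>v (transpose_mat X *\<^sub>v vec n B))"

definition l2_norm_vec :: "real vec \<Rightarrow> real" where
  "l2_norm_vec v = sqrt (\<Sum>i<dim_vec v. (v $ i)\<^sup>2)"

text \<open>Only meaningful in positive dimension.\<close>

definition sup_norm_vec :: "real vec \<Rightarrow> real" where
  "sup_norm_vec v = Max ((\<lambda>i. \<bar>v $ i\<bar>) ` {..<dim_vec v})"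

definition hadamard_cube :: "nat \<Rightarrow> real vec set" where
  "hadamard_cube p =
     {x \<in> carrier_vec (2 ^ p). sup_norm_vec (sylvester_hadamard p *\<^sub>v x) \<le> 1}"

text \<open>
  A vertex is an extreme point: a point of the set in the open segment between no two distinct
  points of it. This transcribes \<open>extreme_point_of\<close> from HOL-Analysis, which needs a type of class
  \<open>real_vector\<close>; the type \<open>real vec\<close>, comprising vectors of all dimensions, is not one.
\<close>

definition vertex_of :: "real vec \<Rightarrow> real vec set \<Rightarrow> bool" where
  "vertex_of x S \<longleftrightarrow> x \<in> S \<and>
     (\<forall>a \<in> S. \<forall>b \<in> S. \<not> (a \<noteq> b \<and>
        (\<exists>u. 0 < u \<and> u < 1 \<and> x = (1 - u) \<cdot>\<^sub>v a + u \<cdot>\<^sub>v b)))"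

end

theory Submission
  imports Defs "Jordan_Normal_Form.Determinant"
begin

text \<open>
  Put \<open>y = H \<beta>\<close>, where \<open>H\<close> is the Hadamard matrix and \<open>\<beta>\<close> the estimator. Each lifted
  observation is a row of \<open>H\<close>, and positive definiteness forces every row to occur in the sample.
  Pairing the normal equations with the rows of \<open>H\<close>, which are orthogonal, shows that \<open>y\<^sub>r\<close> is the
  average of the \<open>B\<^sub>i\<close> over the observations that lift to row \<open>r\<close>. Hence \<open>\<beta>\<close> always lies in the
  cube, and each of the three conditions says that \<open>\<bar>y\<^sub>r\<bar> = 1\<close> for all \<open>r\<close>: the first by
  Parseval's identity, the second because \<open>y\<close> ranges over \<open>[-1, 1]\<^sup>m\<close>, \<open>m = 2\<^sup>p\<close>, as \<open>\<beta>\<close> ranges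
  over the cube, the third because an average of signs is a sign only if the signs agree.
\<close>

section \<open>Sylvester matrices: symmetry, orthogonality and Parseval's identity\<close>

lemma sylvester_hadamard_carrier:
  "sylvester_hadamard p \<in> carrier_mat (2 ^ p) (2 ^ p)"
  by (induction p) (auto simp: Let_def)

lemma dim_sylvester_hadamard [simp]:
  "dim_row (sylvester_hadamard p) = 2 ^ p" "dim_col (sylvester_hadamard p) = 2 ^ p"
  using sylvester_hadamard_carrier[of p] by auto

lemma transpose_sylvester_hadamard:
  "transpose_mat (sylvester_hadamard p) = sylvester_hadamard p"
proof (induction p)
  case (Suc p)
  let ?H = "sylvester_hadamard p"
  have "transpose_mat (- ?H) = - ?H"
    using Suc.IH by (metis transpose_uminus)
  then show ?case
    using transpose_four_block_mat[of ?H "2 ^ p" "2 ^ p" ?H "2 ^ p" ?H "2 ^ p" "- ?H"]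
      Suc.IH sylvester_hadamard_carrier[of p]
    by (simp add: Let_def)
qed auto

text \<open>In the block product the two terms add up on the diagonal and cancel off it.\<close>

lemma sylvester_hadamard_square:
  "sylvester_hadamard p * sylvester_hadamard p = (2 ^ p) \<cdot>\<^sub>m 1\<^sub>m (2 ^ p)"
proof (induction p)
  case 0
  then show ?case by auto
next
  case (Suc p)
  let ?H = "sylvester_hadamard p"
  have H: "?H \<in> carrier_mat (2 ^ p) (2 ^ p)" "- ?H \<in> carrier_mat (2 ^ p) (2 ^ p)"
    using sylvester_hadamard_carrier[of p] by auto
  have "sylvester_hadamard (Suc p) * sylvester_hadamard (Suc p) =
      four_block_mat (?H * ?H + ?H * ?H) (?H * ?H + ?H * (- ?H))
        (?H * ?H + (- ?H) * ?H) (?H * ?H + (- ?H) * (- ?H))"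
    using mult_four_block_mat[OF H(1) H(1) H(1) H(2) H(1) H(1) H(1) H(2)]
    by (simp add: Let_def)
  also have "\<dots> = (2 ^ Suc p) \<cdot>\<^sub>m 1\<^sub>m (2 ^ Suc p)"
    using H by (simp add: Suc.IH) (rule eq_matI; auto)
  finally show ?case .
qed

lemma sylvester_hadamard_mult_mult:
  assumes "x \<in> carrier_vec (2 ^ p)"
  shows "sylvester_hadamard p *\<^sub>v (sylvester_hadamard p *\<^sub>v x) = (2 ^ p) \<cdot>\<^sub>v x"
proof -
  have "sylvester_hadamard p *\<^sub>v (sylvester_hadamard p *\<^sub>v x)
      = ((2 ^ p) \<cdot>\<^sub>m 1\<^sub>m (2 ^ p)) *\<^sub>v x"
    using assms sylvester_hadamard_carrier[of p]
    by (metis assoc_mult_mat_vec sylvester_hadamard_square)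
  also have "\<dots> = (2 ^ p) \<cdot>\<^sub>v x"
    using assms by (intro eq_vecI) auto
  finally show ?thesis .
qed

text \<open>By symmetry a row is also a column, so the product is a column of \<open>H * H\<close>.
  Rows thus serve as test vectors that isolate one coordinate.\<close>

lemma sylvester_hadamard_mult_row:
  assumes "r < 2 ^ p"
  shows "sylvester_hadamard p *\<^sub>v row (sylvester_hadamard p) r = (2 ^ p) \<cdot>\<^sub>v unit_vec (2 ^ p) r"
proof (rule eq_vecI)
  let ?H = "sylvester_hadamard p"
  fix s assume "s < dim_vec ((2 ^ p) \<cdot>\<^sub>v unit_vec (2 ^ p) r :: real vec)"
  then have s: "s < 2 ^ p" by simp
  have "row ?H r = col ?H r"
    using assms transpose_sylvester_hadamard[of p] by (metis dim_sylvester_hadamard(2) row_transpose)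
  then have "(?H *\<^sub>v row ?H r) $ s = (?H * ?H) $$ (s, r)"
    using assms s by simp
  then show "(?H *\<^sub>v row ?H r) $ s = ((2 ^ p) \<cdot>\<^sub>v unit_vec (2 ^ p) r) $ s"
    using assms s by (simp add: sylvester_hadamard_square)
qed simp

lemma sylvester_hadamard_inj:
  assumes "x \<in> carrier_vec (2 ^ p)" "y \<in> carrier_vec (2 ^ p)"
    and "sylvester_hadamard p *\<^sub>v x = sylvester_hadamard p *\<^sub>v y"
  shows "x = y"
proof (rule eq_vecI)
  fix i assume "i < dim_vec y"
  moreover have "((2 ^ p) \<cdot>\<^sub>v x) $ i = ((2 ^ p) \<cdot>\<^sub>v y) $ i"
    using sylvester_hadamard_mult_mult assms by metis
  ultimately show "x $ i = y $ i" using assms by simp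
qed (use assms in simp)

text \<open>Parseval's identity: moving one factor \<open>H\<close> across the inner product leaves
  \<open>H (H x)\<close>, a multiple of \<open>x\<close>.\<close>

lemma l2_norm_sylvester_hadamard:
  assumes x: "x \<in> carrier_vec (2 ^ p)"
  shows "(\<Sum>r<2 ^ p. ((sylvester_hadamard p *\<^sub>v x) $ r)\<^sup>2) = 2 ^ p * (l2_norm_vec x)\<^sup>2"
proof -
  let ?H = "sylvester_hadamard p"
  have "(\<Sum>r<2 ^ p. ((?H *\<^sub>v x) $ r)\<^sup>2) = (transpose_mat ?H *\<^sub>v (?H *\<^sub>v x)) \<bullet> x"
    using x sylvester_hadamard_carrier[of p]
    by (subst transpose_vec_mult_scalar[of ?H "2 ^ p" "2 ^ p"])
      (auto simp: scalar_prod_def power2_eq_square lessThan_atLeast0)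
  also have "\<dots> = ((2 ^ p) \<cdot>\<^sub>v x) \<bullet> x"
    using x by (simp only: transpose_sylvester_hadamard sylvester_hadamard_mult_mult)
  also have "\<dots> = 2 ^ p * (\<Sum>i<dim_vec x. (x $ i)\<^sup>2)"
    by (simp add: scalar_prod_def power2_eq_square sum_distrib_left lessThan_atLeast0 mult.assoc)
  finally show ?thesis
    by (simp add: l2_norm_vec_def sum_nonneg)
qed

section \<open>Kronecker lifts and Sylvester rows\<close>

lemma kron_lift_eq_row_sylvester_hadamard:
  assumes "a \<in> carrier_vec p" and "\<And>j. j < p \<Longrightarrow> a $ j \<in> {-1, 1}"
  shows "\<exists>r<2 ^ p. kron_lift a = row (sylvester_hadamard p) r"
proof -
  have "set xs \<subseteq> {-1, 1} \<Longrightarrow> \<exists>r<2 ^ length xs.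
      foldr (\<lambda>x. kron_vec (vec_of_list [1, x])) xs (vec_of_list [1])
        = row (sylvester_hadamard (length xs)) r" for xs :: "real list"
  proof (induction xs)
    case Nil
    show ?case by (auto intro!: eq_vecI)
  next
    case (Cons x xs)
    let ?N = "2 ^ length xs :: nat"
    let ?H = "sylvester_hadamard (length xs)"
    from Cons obtain r where r: "r < ?N"
      and w: "foldr (\<lambda>x. kron_vec (vec_of_list [1, x])) xs (vec_of_list [1]) = row ?H r"
      by auto
    \<comment> \<open>A leading sign \<open>x\<close> turns the row \<open>w\<close> into the
      concatenation of \<open>w\<close> and \<open>x * w\<close>: row \<open>r\<close> of the upper
      blocks for 1, of the lower blocks for -1.\<close>
    define s where "s = (if x = 1 then r else r + ?N)"
    have s: "s < 2 ^ length (x # xs)" using r by (simp add: s_def)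
    have x: "x = 1 \<or> x = -1" using Cons.prems by auto
    have "kron_vec (vec_of_list [1, x]) (row ?H r) = row (sylvester_hadamard (Suc (length xs))) s"
    proof (rule eq_vecI)
      fix i assume "i < dim_vec (row (sylvester_hadamard (Suc (length xs))) s)"
      then have i: "i < 2 * ?N" by (simp del: sylvester_hadamard.simps)
      show "kron_vec (vec_of_list [1, x]) (row ?H r) $ i
          = row (sylvester_hadamard (Suc (length xs))) s $ i"
      proof (cases "i < ?N")
        case True
        then show ?thesis
          using i r s x by (auto simp: kron_vec_def s_def Let_def)
      next
        case False
        then have "i div ?N = 1" "i mod ?N = i - ?N"
          using i by (auto simp: div_nat_eqI mod_if)
        then show ?thesis
          using i r s x False by (auto simp: kron_vec_def s_def Let_def)
      qed
    qed (simp add: kron_vec_def del: sylvester_hadamard.simps)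
    then show ?case using s w by auto
  qed
  moreover have "set (list_of_vec a) \<subseteq> {-1, 1}"
    using assms by (force simp: in_set_conv_nth)
  ultimately show ?thesis
    using assms(1) unfolding kron_lift_def by (metis carrier_vecD length_list_of_vec)
qed

section \<open>The cube in Hadamard coordinates: membership, vertices and norm\<close>

lemma mem_hadamard_cube:
  "x \<in> hadamard_cube p \<longleftrightarrow>
    x \<in> carrier_vec (2 ^ p) \<and> (\<forall>r<2 ^ p. \<bar>(sylvester_hadamard p *\<^sub>v x) $ r\<bar> \<le> 1)"
proof -
  \<comment> \<open>\<open>Max\<close> can be bounded coordinatewise only over a nonempty index
    set.\<close>
  have "{..<2 ^ p} \<noteq> ({} :: nat set)" by (auto simp: lessThan_empty_iff)
  then show ?thesis
    by (auto simp: hadamard_cube_def sup_norm_vec_def)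
qed

lemma convex_combination_extreme:
  fixes a b u :: real
  assumes "\<bar>(1 - u) * a + u * b\<bar> = 1" "\<bar>a\<bar> \<le> 1" "\<bar>b\<bar> \<le> 1" "0 < u" "u < 1"
  shows "a = b"
proof -
  \<comment> \<open>These are the weighted distances of \<open>a\<close> and \<open>b\<close> to 1
    and to -1. If the combination equals an endpoint, the two distances to it sum to 0, so both
    vanish.\<close>
  have "(1 - u) * (1 - a) \<ge> 0" "u * (1 - b) \<ge> 0" "(1 - u) * (1 + a) \<ge> 0" "u * (1 + b) \<ge> 0"
    using assms by auto
  moreover have "(1 - u) * a + u * b = 1 \<or> (1 - u) * a + u * b = - 1"
    using assms(1) by linarith
  ultimately have "(1 - u) * (1 - a) = 0 \<and> u * (1 - b) = 0 \<or> (1 - u) * (1 + a) = 0 \<and> u * (1 + b) = 0"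
    by (simp only: algebra_simps) linarith
  then show ?thesis using assms(4,5) by auto
qed

text \<open>A coordinate strictly inside [-1, 1] leaves room to move both ways. Conversely, signs
  are extreme in [-1, 1], which fixes every coordinate of \<open>H a\<close> and \<open>H b\<close>,
  and \<open>H\<close> is injective.\<close>

lemma vertex_of_hadamard_cube:
  assumes x: "x \<in> hadamard_cube p"
  shows "vertex_of x (hadamard_cube p) \<longleftrightarrow>
    (\<forall>r<2 ^ p. \<bar>(sylvester_hadamard p *\<^sub>v x) $ r\<bar> = 1)"
proof
  let ?H = "sylvester_hadamard p"
  note H = sylvester_hadamard_carrier[of p]
  have xc: "x \<in> carrier_vec (2 ^ p)" using x by (simp add: mem_hadamard_cube)
  {
    assume v: "vertex_of x (hadamard_cube p)"
    show "\<forall>r<2 ^ p. \<bar>(?H *\<^sub>v x) $ r\<bar> = 1"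
    proof (rule ccontr)
      assume "\<not> ?thesis"
      then obtain r where r: "r < 2 ^ p" "\<bar>(?H *\<^sub>v x) $ r\<bar> < 1"
        using x unfolding mem_hadamard_cube by force
      \<comment> \<open>Scaled so that \<open>H d\<close> is the slack of coordinate
        \<open>r\<close> times a unit vector; then \<open>x + d\<close> and \<open>x - d\<close>
        both stay in the cube.\<close>
      define e where "e = (1 - \<bar>(?H *\<^sub>v x) $ r\<bar>) / 2 ^ p"
      define d where "d = e \<cdot>\<^sub>v row ?H r"
      have e: "e > 0" "e * 2 ^ p = 1 - \<bar>(?H *\<^sub>v x) $ r\<bar>" using r by (auto simp: e_def)
      have dc: "d \<in> carrier_vec (2 ^ p)" by (simp add: d_def carrier_vecI)
      have Hd: "?H *\<^sub>v d = (e * 2 ^ p) \<cdot>\<^sub>v unit_vec (2 ^ p) r"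
        using H r(1) unfolding d_def
        by (simp add: mult_mat_vec[OF H] carrier_vecI sylvester_hadamard_mult_row smult_smult_assoc)
      have plus: "x + d \<in> hadamard_cube p"
        using x xc dc Hd e r
        by (auto simp: mem_hadamard_cube mult_add_distrib_mat_vec[OF H])
      have minus: "x - d \<in> hadamard_cube p"
        using x xc dc Hd e r
        by (auto simp: mem_hadamard_cube mult_minus_distrib_mat_vec[OF H])
      have "x + d \<noteq> x - d"
      proof
        assume "x + d = x - d"
        then have "(?H *\<^sub>v (x + d)) $ r = (?H *\<^sub>v (x - d)) $ r" by simp
        then show False
          using xc dc Hd e r
          by (auto simp: mult_add_distrib_mat_vec[OF H] mult_minus_distrib_mat_vec[OF H])
      qed
      moreover have "x = (1 - 1 / 2) \<cdot>\<^sub>v (x + d) + (1 / 2) \<cdot>\<^sub>v (x - d)"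
        using xc dc by (intro eq_vecI) (auto simp: field_simps)
      then have "\<exists>u>0. u < 1 \<and> x = (1 - u) \<cdot>\<^sub>v (x + d) + u \<cdot>\<^sub>v (x - d)"
        by (intro exI[of _ "1 / 2"]) simp
      ultimately show False
        using v plus minus unfolding vertex_of_def by blast
    qed
  next
    assume one: "\<forall>r<2 ^ p. \<bar>(?H *\<^sub>v x) $ r\<bar> = 1"
    have "a = b" if a: "a \<in> hadamard_cube p" and b: "b \<in> hadamard_cube p"
      and u: "0 < u" "u < 1" "x = (1 - u) \<cdot>\<^sub>v a + u \<cdot>\<^sub>v b" for a b u
    proof (rule sylvester_hadamard_inj)
      show ac: "a \<in> carrier_vec (2 ^ p)" and bc: "b \<in> carrier_vec (2 ^ p)"
        using a b by (auto simp: mem_hadamard_cube)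
      show "?H *\<^sub>v a = ?H *\<^sub>v b"
      proof (rule eq_vecI)
        fix r assume "r < dim_vec (?H *\<^sub>v b)"
        then have r: "r < 2 ^ p" by simp
        have "?H *\<^sub>v x = (1 - u) \<cdot>\<^sub>v (?H *\<^sub>v a) + u \<cdot>\<^sub>v (?H *\<^sub>v b)"
          using ac bc unfolding u(3)
          by (simp add: mult_add_distrib_mat_vec[OF H] mult_mat_vec[OF H])
        then have "(?H *\<^sub>v x) $ r = (1 - u) * (?H *\<^sub>v a) $ r + u * (?H *\<^sub>v b) $ r"
          using r by simp
        then show "(?H *\<^sub>v a) $ r = (?H *\<^sub>v b) $ r"
          using r a b one u(1,2) unfolding mem_hadamard_cube
          by (metis convex_combination_extreme)
      qed simp
    qed
    then show "vertex_of x (hadamard_cube p)"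
      using x unfolding vertex_of_def by blast
  }
qed

text \<open>By Parseval, norm 1 means that the \<open>2 ^ p\<close> squared coordinates, each at
  most 1, sum to \<open>2 ^ p\<close>; so none falls short of 1.\<close>

lemma l2_norm_eq_1_iff_hadamard_cube:
  assumes x: "x \<in> hadamard_cube p"
  shows "l2_norm_vec x = 1 \<longleftrightarrow> (\<forall>r<2 ^ p. \<bar>(sylvester_hadamard p *\<^sub>v x) $ r\<bar> = 1)"
proof -
  let ?y = "\<lambda>r. (sylvester_hadamard p *\<^sub>v x) $ r"
  have xc: "x \<in> carrier_vec (2 ^ p)" and le: "\<And>r. r < 2 ^ p \<Longrightarrow> (?y r)\<^sup>2 \<le> 1"
    using x by (auto simp: mem_hadamard_cube abs_square_le_1)
  have "l2_norm_vec x \<ge> 0" by (simp add: l2_norm_vec_def sum_nonneg)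
  then have "l2_norm_vec x = 1 \<longleftrightarrow> 2 ^ p * (l2_norm_vec x)\<^sup>2 = 2 ^ p"
    by (simp add: abs_square_eq_1)
  also have "\<dots> \<longleftrightarrow> (\<Sum>r<2 ^ p. 1 - (?y r)\<^sup>2) = 0"
    unfolding l2_norm_sylvester_hadamard[OF xc, symmetric] by (auto simp: sum_subtractf)
  also have "\<dots> \<longleftrightarrow> (\<forall>r\<in>{..<2 ^ p}. 1 - (?y r)\<^sup>2 = 0)"
    using le by (intro sum_nonneg_eq_0_iff) auto
  also have "\<dots> \<longleftrightarrow> (\<forall>r<2 ^ p. \<bar>?y r\<bar> = 1)"
    by (auto simp: abs_square_eq_1)
  finally show ?thesis .
qed

section \<open>Invertibility of the Gram matrix and averages of signs\<close>

lemma pos_def_mat_mult_inverse: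
  assumes M: "M \<in> carrier_mat m m" and pd: "pos_def_mat M"
  shows "the (mat_inverse M) \<in> carrier_mat m m" "M * the (mat_inverse M) = 1\<^sub>m m"
proof -
  \<comment> \<open>A nonzero kernel vector would make the quadratic form vanish.\<close>
  have "det M \<noteq> 0"
  proof
    assume "det M = 0"
    then obtain v where v: "v \<in> carrier_vec m" "v \<noteq> 0\<^sub>v m" "M *\<^sub>v v = 0\<^sub>v m"
      using det_0_iff_vec_prod_zero_field[OF M] by auto
    then have "v \<bullet> (M *\<^sub>v v) > 0" using pd M unfolding pos_def_mat_def by auto
    then show False using v by simp
  qed
  \<comment> \<open>The argument \<open>()\<close> fixes the record extension of the matrix ring, so
    that both facts speak of units of the same ring.\<close>
  then obtain I where "mat_inverse M = Some I"
    using mat_inverse(1)[OF M, of "()"] det_non_zero_imp_unit[OF M, of "()"]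
    by (cases "mat_inverse M") auto
  then show "the (mat_inverse M) \<in> carrier_mat m m" "M * the (mat_inverse M) = 1\<^sub>m m"
    using mat_inverse(2)[OF M] by auto
qed

text \<open>\<open>avg\<close> makes \<open>y\<close> the mean of \<open>f\<close> over
  \<open>S\<close> without dividing by the cardinality. If \<open>y\<close> lies outside (-1, 1),
  all deviations \<open>y - f i\<close> have the same sign; their sum being 0, they vanish termwise,
  which rules out values beyond 1 or -1.\<close>

lemma sign_average:
  fixes f :: "'a \<Rightarrow> real"
  assumes fin: "finite S" and ne: "S \<noteq> {}" and f: "\<And>i. i \<in> S \<Longrightarrow> f i \<in> {-1, 1}"
    and avg: "(\<Sum>i\<in>S. y - f i) = 0"
  shows "\<bar>y\<bar> \<le> 1" and "\<bar>y\<bar> = 1 \<longleftrightarrow> (\<forall>i\<in>S. f i = y)"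
proof -
  have "\<not> y > 1"
  proof
    assume "y > 1"
    then have "0 < (\<Sum>i\<in>S. y - f i)" using fin ne f by (intro sum_pos) force+
    then show False using avg by simp
  qed
  moreover have "\<not> y < -1"
  proof
    assume "y < -1"
    then have "0 < (\<Sum>i\<in>S. - (y - f i))" using fin ne f by (intro sum_pos) force+
    then show False using avg unfolding sum_negf by simp
  qed
  ultimately show le: "\<bar>y\<bar> \<le> 1" by auto
  show "\<bar>y\<bar> = 1 \<longleftrightarrow> (\<forall>i\<in>S. f i = y)"
  proof
    assume "\<bar>y\<bar> = 1"
    then consider "y = 1" | "y = -1" by linarith
    then show "\<forall>i\<in>S. f i = y"
    proof cases
      case 1
      then have "\<forall>i\<in>S. y - f i = 0"
        using avg fin f by (subst (asm) sum_nonneg_eq_0_iff) force+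
      then show ?thesis by auto
    next
      case 2
      have "(\<Sum>i\<in>S. - (y - f i)) = 0" using avg unfolding sum_negf by simp
      then have "\<forall>i\<in>S. - (y - f i) = 0"
        using 2 fin f by (subst (asm) sum_nonneg_eq_0_iff) force+
      then show ?thesis by auto
    qed
  next
    assume "\<forall>i\<in>S. f i = y"
    then show "\<bar>y\<bar> = 1" using ne f by force
  qed
qed

section \<open>The least-squares estimator in Hadamard coordinates\<close>

theorem theorem4p5:
  fixes p n :: nat and A :: "nat \<Rightarrow> real vec" and B :: "nat \<Rightarrow> real"
  assumes A_dim: "\<And>i. i < n \<Longrightarrow> A i \<in> carrier_vec p"
    and A_bin: "\<And>i j. i < n \<Longrightarrow> j < p \<Longrightarrow> A i $ j \<in> {-1, 1}"
    and B_bin: "\<And>i. i < n \<Longrightarrow> B i \<in> {-1, 1}"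
    and pos_def: "pos_def_mat (transpose_mat (design_mat p n A) * design_mat p n A)"
  shows "(l2_norm_vec (beta_hat p n A B) = 1
            \<longleftrightarrow> vertex_of (beta_hat p n A B) (hadamard_cube p))
       \<and> (vertex_of (beta_hat p n A B) (hadamard_cube p)
            \<longleftrightarrow> (\<forall>i<n. B i = beta_hat p n A B \<bullet> kron_lift (A i)))"
proof -
  let ?N = "2 ^ p :: nat"
  define H where "H = sylvester_hadamard p"
  define X where "X = design_mat p n A"
  define b where "b = beta_hat p n A B"
  define y where "y = H *\<^sub>v b"
  have H: "H \<in> carrier_mat ?N ?N"
    unfolding H_def by (rule sylvester_hadamard_carrier)
  have X: "X \<in> carrier_mat n ?N" by (simp add: X_def design_mat_def)
  have M: "transpose_mat X * X \<in> carrier_mat ?N ?N" using X by simp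
  define I where "I = the (mat_inverse (transpose_mat X * X))"
  have I: "I \<in> carrier_mat ?N ?N" "transpose_mat X * X * I = 1\<^sub>m ?N"
    using pos_def_mat_mult_inverse[OF M] pos_def unfolding I_def X_def by auto
  have b: "b = I *\<^sub>v (transpose_mat X *\<^sub>v vec n B)"
    by (simp add: b_def beta_hat_def Let_def I_def X_def)
  have bc: "b \<in> carrier_vec ?N" using I(1) by (simp add: b carrier_vecI)
  have Xb: "X *\<^sub>v b \<in> carrier_vec n" "vec n B \<in> carrier_vec n"
    using X by (auto simp: carrier_vecI)
  have normal: "transpose_mat X *\<^sub>v (X *\<^sub>v b) = transpose_mat X *\<^sub>v vec n B"
  proof -
    have "transpose_mat X *\<^sub>v (X *\<^sub>v b) = (transpose_mat X * X) *\<^sub>v b"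
      using X bc by (simp add: assoc_mult_mat_vec[of _ ?N n _ ?N])
    also have "\<dots> = (transpose_mat X * X * I) *\<^sub>v (transpose_mat X *\<^sub>v vec n B)"
      unfolding b using X M I(1) by (subst assoc_mult_mat_vec[OF M I(1)]) (auto simp: carrier_vecI)
    also have "\<dots> = transpose_mat X *\<^sub>v vec n B"
      using X by (simp add: I(2) carrier_vecI)
    finally show ?thesis .
  qed
  \<comment> \<open>The bound on \<open>i\<close> sits inside the existential so that choice yields
    a total function \<rho>, sending each observation to its row of \<open>H\<close>.\<close>
  have "\<forall>i. \<exists>r. i < n \<longrightarrow> r < ?N \<and> kron_lift (A i) = row H r"
    unfolding H_def using kron_lift_eq_row_sylvester_hadamard A_dim A_bin by blast
  then obtain \<rho> where \<rho>: "\<And>i. i < n \<Longrightarrow> \<rho> i < ?N"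
    and lift: "\<And>i. i < n \<Longrightarrow> kron_lift (A i) = row H (\<rho> i)"
    by metis
  have rowX: "row X i = row H (\<rho> i)" if "i < n" for i
    using that lift[OF that] H
    by (intro eq_vecI) (auto simp: X_def design_mat_def)
  have Xv: "(X *\<^sub>v v) $ i = (H *\<^sub>v v) $ \<rho> i" if "i < n" for i v
    using that X H \<rho> by (simp add: rowX)
  have Hrow: "H *\<^sub>v row H r = 2 ^ p \<cdot>\<^sub>v unit_vec ?N r" if "r < ?N" for r
    unfolding H_def by (rule sylvester_hadamard_mult_row[OF that])
  \<comment> \<open>Applied to row \<open>r\<close>, \<open>X\<close> gives \<open>2 ^ p\<close>
    times the indicator of the observations lifting to it.\<close>
  have Xrow: "(X *\<^sub>v row H r) $ i = (if \<rho> i = r then 2 ^ p else 0)" if "i < n" "r < ?N" for i r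
    using that \<rho> by (simp add: Xv Hrow)
  \<comment> \<open>A row missing from the sample is orthogonal to every row of \<open>X\<close>,
    hence a nonzero kernel vector of the Gram matrix.\<close>
  have surj: "\<exists>i<n. \<rho> i = r" if r: "r < ?N" for r
  proof (rule ccontr)
    assume "\<not> ?thesis"
    then have "X *\<^sub>v row H r = 0\<^sub>v n"
      using X r Xrow by (intro eq_vecI) auto
    moreover have "transpose_mat X *\<^sub>v 0\<^sub>v n = 0\<^sub>v ?N"
      using X by (intro eq_vecI) auto
    ultimately have "(transpose_mat X * X) *\<^sub>v row H r = 0\<^sub>v ?N"
      using X H r by (simp add: assoc_mult_mat_vec[of _ ?N n _ ?N])
    moreover have "row H r \<noteq> 0\<^sub>v ?N"
    proof
      assume "row H r = 0\<^sub>v ?N"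
      then have "(H *\<^sub>v row H r) $ r = 0" using H r by simp
      then show False using r by (simp add: Hrow)
    qed
    ultimately show False
      using pos_def M H r unfolding X_def[symmetric] pos_def_mat_def
      by (metis carrier_matD(1) less_irrefl row_carrier_vec scalar_prod_right_zero)
  qed
  have avg: "(\<Sum>i | i < n \<and> \<rho> i = r. y $ r - B i) = 0" if r: "r < ?N" for r
  proof -
    have rc: "row H r \<in> carrier_vec ?N" using H r by simp
    \<comment> \<open>The residual is orthogonal to the range of \<open>X\<close>, in particular to
      the scaled indicator from \<open>Xrow\<close>.\<close>
    have "(X *\<^sub>v b) \<bullet> (X *\<^sub>v row H r) = vec n B \<bullet> (X *\<^sub>v row H r)"
      using normal transpose_vec_mult_scalar[OF X rc] Xb by metis
    then have "(\<Sum>i<n. (y $ \<rho> i - B i) * (if \<rho> i = r then 2 ^ p else 0)) = 0"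
      using X r
      by (simp add: scalar_prod_def Xv[of _ b] Xrow y_def lessThan_atLeast0 left_diff_distrib
          sum_subtractf del: index_mult_mat_vec)
    also have "(\<Sum>i<n. (y $ \<rho> i - B i) * (if \<rho> i = r then 2 ^ p else 0))
        = (\<Sum>i | i < n \<and> \<rho> i = r. (y $ r - B i) * 2 ^ p)"
      by (rule sum.mono_neutral_cong_right) auto
    finally show ?thesis by (simp add: sum_distrib_right[symmetric])
  qed
  note average = sign_average[where f = B and S = "{i. i < n \<and> \<rho> i = r}" and y = "y $ r" for r]
  \<comment> \<open>\<open>surj\<close> supplies the nonempty set over which the average is
    taken.\<close>
  have le: "\<bar>y $ r\<bar> \<le> 1"
    and eq: "\<bar>y $ r\<bar> = 1 \<longleftrightarrow> (\<forall>i<n. \<rho> i = r \<longrightarrow> B i = y $ r)" if r: "r < ?N" for r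
    using average[of r] surj[OF r] avg[OF r] B_bin by auto
  have cube: "b \<in> hadamard_cube p"
    using bc le unfolding mem_hadamard_cube y_def H_def by blast
  have fit: "b \<bullet> kron_lift (A i) = y $ \<rho> i" if "i < n" for i
    using that H bc \<rho>[OF that] comm_scalar_prod[OF bc, of "row H (\<rho> i)"]
    by (simp add: lift y_def)
  \<comment> \<open>The fibres of \<rho> over all \<open>r < 2 ^ p\<close> partition the
    observations, so the conditions from \<open>eq\<close> combine into one over all
    \<open>i < n\<close>.\<close>
  have "(\<forall>r<?N. \<bar>y $ r\<bar> = 1) \<longleftrightarrow> (\<forall>i<n. B i = b \<bullet> kron_lift (A i))"
    using eq \<rho> fit by auto
  then show ?thesis
    using vertex_of_hadamard_cube[OF cube] l2_norm_eq_1_iff_hadamard_cube[OF cube]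
    unfolding b_def y_def H_def by simp
qed

end
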